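(* Let $\mathcal{B}$ and $\mathcal{C}$ be binary partitions of $[0,n]=\{0,1,\dots,n\}$. Then $\mathcal{C}\le\mathcal{B}$ (that is, $\mathcal{C}$ is a contraction of $\mathcal{B}$) if and only if the bipartite graph $G(\mathcal{B},\mathcal{C})$ satisfies all of the following conditions: (1) $G(\mathcal{B},\mathcal{C})$ is non-crossing. (2) Every left non-homogeneous vertex $v$ satisfies $\deg^\vee(v)\le 1$. (3) Every left homogeneous vertex $v$ satisfies $\deg^\star(v)=1$ and $\deg^\vee(v)=0$. (4) Every right non-homogeneous vertex $v$ satisfies $\deg^\star(v)=0$ and $\deg^\vee(v)=1$. (5) If a right homogeneous vertex $v$ satisfies $\deg(v)=1$, then $\deg^\star(v)=1$.
   Context: A binary partition of $[0,n]$ into $k\ge1$ blocks is an ordered tuple $(B_1,\dots,B_k)$ of nonempty disjoint subsets with union $[0,n]$, where each block is labelled either homogeneous or non-homogeneous, and every singleton block is non-homogeneous. The associated preorder $\preceq_{\mathcal{B}}$ (reflexive transitive relation) on $[0,n]$ is: $p\preceq_{\mathcal{B}}q$ if $p\in B_i$, $q\in B_j$ with $i<j$; $p\preceq_{\mathcal B} q$ and $q\preceq_{\mathcal B}p$ if $p,q$ lie in the same homogeneous block; and $p\preceq_{\mathcal B}p$ for all $p$ (distinct elements of a non-homogeneous block are incomparable). A preorder $\preceq$ on a finite set $A$ has equivalence relation $i\equiv j\iff i\preceq j\preceq i$, and induces a partial order on the set of equivalence classes; its Hasse diagram is the Hasse diagram of this poset of classes. A preorder $\preceq_1$ on $A$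 is a contraction of a preorder $\preceq_2$ on $A$ if the Hasse diagram of $\preceq_1$ is obtained from that of $\preceq_2$ by a (possibly empty) sequence of edge contractions; contracting an edge $\bar g\lessdot\bar h$ merges the two classes $\bar g,\bar h$ into one class $\bar g\cup\bar h$, with the resulting preorder being the transitive closure of the old one together with $\bar h\preceq\bar g$. A binary partition $\mathcal{C}$ is a contraction of $\mathcal{B}$, written $\mathcal{C}\le\mathcal{B}$, if $\preceq_{\mathcal{C}}$ is a contraction of $\preceq_{\mathcal{B}}$. For $\mathcal{B}=(B_1,\dots,B_p)$ and $\mathcal{C}=(C_1,\dots,C_q)$, $G(\mathcal{B},\mathcal{C})$ is the bipartite graph with left vertices $B_1,\dots,B_p$ and right vertices $C_1,\dots,C_q$ (each side drawn in this order), with $B_i$ adjacent to $C_j$ iff $B_i\cap C_j\ne\emptyset$. It is non-crossing if its edges do not cross, i.e. there are no edges $B_iC_j$, $B_{i'}C_{j'}$ with $i<i'$ and $j>j'$. A vertex is homogeneous or non-homogeneous according to its block. For a vertex $v$, $\deg^\star(v)$ is the number of homogeneous vertices adjacent to $v$, $\deg^\vee(v)$ is the number of non-homogeneous vertices adjacent to $v$, and $\deg(v)=\deg^\star(v)+\deg^\vee(v)$. *)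

theory Defs
  imports Main
begin

datatype block_label = Hom | NonHom

type_synonym labelled_blocks = "(nat set \<times> block_label) list"

text \<open>Blocks are indexed from 0, so the block called \<open>B\<^sub>i\<close> on paper is \<open>blk B (i - 1)\<close>.\<close>

definition blk :: "labelled_blocks \<Rightarrow> nat \<Rightarrow> nat set" where
  "blk B i = fst (B ! i)"

definition is_hom :: "labelled_blocks \<Rightarrow> nat \<Rightarrow> bool" where
  "is_hom B i \<longleftrightarrow> snd (B ! i) = Hom"

definition binary_partition :: "nat \<Rightarrow> labelled_blocks \<Rightarrow> bool" where
  "binary_partition n B \<longleftrightarrow>
     1 \<le> length B \<and>
     (\<forall>i<length B. blk B i \<noteq> {}) \<and>
     (\<forall>i<length B. \<forall>j<length B. i \<noteq> j \<longrightarrow> blk B i \<inter> blk B j = {}) \<and>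
     (\<Union>i<length B. blk B i) = {0..n} \<and>
     (\<forall>i<length B. card (blk B i) = 1 \<longrightarrow> \<not> is_hom B i)"

definition bp_preorder :: "nat \<Rightarrow> labelled_blocks \<Rightarrow> (nat \<times> nat) set" where
  "bp_preorder n B =
     {(p, q). \<exists>i j. i < j \<and> j < length B \<and> p \<in> blk B i \<and> q \<in> blk B j} \<union>
     {(p, q). \<exists>i<length B. is_hom B i \<and> p \<in> blk B i \<and> q \<in> blk B i} \<union>
     Id_on {0..n}"


definition preorder_classes :: "'a set \<Rightarrow> ('a \<times> 'a) set \<Rightarrow> 'a set set" where
  "preorder_classes A r = A // (r \<inter> r\<inverse>)"

definition class_le :: "('a \<times> 'a) set \<Rightarrow> 'a set \<Rightarrow> 'a set \<Rightarrow> bool" where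
  "class_le r g h \<longleftrightarrow> (\<exists>x\<in>g. \<exists>y\<in>h. (x, y) \<in> r)"

definition class_less :: "('a \<times> 'a) set \<Rightarrow> 'a set \<Rightarrow> 'a set \<Rightarrow> bool" where
  "class_less r g h \<longleftrightarrow> class_le r g h \<and> g \<noteq> h"

definition hasse_edges :: "'a set \<Rightarrow> ('a \<times> 'a) set \<Rightarrow> ('a set \<times> 'a set) set" where
  "hasse_edges A r =
     {(g, h). g \<in> preorder_classes A r \<and> h \<in> preorder_classes A r \<and> class_less r g h \<and>
        \<not> (\<exists>k \<in> preorder_classes A r. class_less r g k \<and> class_less r k h)}"

text \<open>Contracting the edge \<open>g \<lessdot> h\<close> adds \<open>h \<preceq> g\<close> and closes transitively. The result
  is again a preorder, and a further contraction uses an edge of \<^emph>\<open>its\<close> Hasse diagram.\<close>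

definition edge_contraction :: "'a set \<Rightarrow> ('a \<times> 'a) set \<Rightarrow> ('a \<times> 'a) set \<Rightarrow> bool" where
  "edge_contraction A r r' \<longleftrightarrow> (\<exists>(g, h) \<in> hasse_edges A r. r' = (r \<union> h \<times> g)\<^sup>+)"

definition preorder_contraction :: "'a set \<Rightarrow> ('a \<times> 'a) set \<Rightarrow> ('a \<times> 'a) set \<Rightarrow> bool" where
  "preorder_contraction A r1 r2 \<longleftrightarrow>
     preorder_on A r1 \<and> preorder_on A r2 \<and> (edge_contraction A)\<^sup>*\<^sup>* r2 r1"

definition bp_contraction :: "nat \<Rightarrow> labelled_blocks \<Rightarrow> labelled_blocks \<Rightarrow> bool" where
  "bp_contraction n C B \<longleftrightarrow> preorder_contraction {0..n} (bp_preorder n C) (bp_preorder n B)"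


text \<open>\<open>Inl i\<close> is the left vertex given by the \<open>i\<close>-th block of \<open>B\<close>, and \<open>Inr j\<close> the right
  vertex given by the \<open>j\<close>-th block of \<open>C\<close>. A set occurring as a block on both sides thus gives
  two vertices.\<close>

type_synonym vertex = "nat + nat"

definition left_vertices :: "labelled_blocks \<Rightarrow> vertex set" where
  "left_vertices B = Inl ` {..<length B}"

definition right_vertices :: "labelled_blocks \<Rightarrow> vertex set" where
  "right_vertices C = Inr ` {..<length C}"

definition graph_edges :: "labelled_blocks \<Rightarrow> labelled_blocks \<Rightarrow> vertex set set" where
  "graph_edges B C =
     {{Inl i, Inr j} | i j. i < length B \<and> j < length C \<and> blk B i \<inter> blk C j \<noteq> {}}"

definition non_crossing :: "labelled_blocks \<Rightarrow> labelled_blocks \<Rightarrow> bool" where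
  "non_crossing B C \<longleftrightarrow>
     \<not> (\<exists>i i' j j'. {Inl i, Inr j} \<in> graph_edges B C \<and> {Inl i', Inr j'} \<in> graph_edges B C \<and>
          i < i' \<and> j > j')"

fun hom_vertex :: "labelled_blocks \<Rightarrow> labelled_blocks \<Rightarrow> vertex \<Rightarrow> bool" where
  "hom_vertex B C (Inl i) = is_hom B i"
| "hom_vertex B C (Inr j) = is_hom C j"

definition neighbours :: "labelled_blocks \<Rightarrow> labelled_blocks \<Rightarrow> vertex \<Rightarrow> vertex set" where
  "neighbours B C v = {w \<in> left_vertices B \<union> right_vertices C. {v, w} \<in> graph_edges B C}"

definition deg_star :: "labelled_blocks \<Rightarrow> labelled_blocks \<Rightarrow> vertex \<Rightarrow> nat" where
  "deg_star B C v = card {w \<in> neighbours B C v. hom_vertex B C w}"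

definition deg_vee :: "labelled_blocks \<Rightarrow> labelled_blocks \<Rightarrow> vertex \<Rightarrow> nat" where
  "deg_vee B C v = card {w \<in> neighbours B C v. \<not> hom_vertex B C w}"

definition deg :: "labelled_blocks \<Rightarrow> labelled_blocks \<Rightarrow> vertex \<Rightarrow> nat" where
  "deg B C v = deg_star B C v + deg_vee B C v"


lemma preorder_on_bp_preorder:
  assumes "binary_partition n B"
  shows "preorder_on {0..n} (bp_preorder n B)"
proof -
  have sub: "p \<in> {0..n}" if "i < length B" "p \<in> blk B i" for p i
    using assms that unfolding binary_partition_def by blast
  have uniq: "i = j" if "i < length B" "j < length B" "p \<in> blk B i" "p \<in> blk B j" for p i j
    using assms that unfolding binary_partition_def by blast
  have cases: "x = y \<and> x \<in> {0..n} \<or> (\<exists>i j. i \<le> j \<and> j < length B \<and> (i = j \<longrightarrow> is_hom B i) \<and>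
      x \<in> blk B i \<and> y \<in> blk B j)" if "(x, y) \<in> bp_preorder n B" for x y
    using that unfolding bp_preorder_def by (auto intro: less_imp_le)
  have "bp_preorder n B \<subseteq> {0..n} \<times> {0..n}"
  proof (rule subrelI)
    fix x y assume "(x, y) \<in> bp_preorder n B"
    from cases[OF this] show "(x, y) \<in> {0..n} \<times> {0..n}"
      using sub by (blast dest: le_less_trans)
  qed
  moreover have "refl_on {0..n} (bp_preorder n B)"
    unfolding bp_preorder_def refl_on_def by blast
  moreover have "trans (bp_preorder n B)"
  proof (rule transI)
    fix p q s
    assume pq: "(p, q) \<in> bp_preorder n B" and qs: "(q, s) \<in> bp_preorder n B"
    show "(p, s) \<in> bp_preorder n B"
    proof (cases "p = q \<or> q = s")
      case True
      then show ?thesis using pq qs by blast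
    next
      case False
      obtain i j where ij: "i \<le> j" "j < length B" "i = j \<longrightarrow> is_hom B i" "p \<in> blk B i" "q \<in> blk B j"
        using cases[OF pq] False by blast
      obtain k l where kl: "k \<le> l" "l < length B" "k = l \<longrightarrow> is_hom B k" "q \<in> blk B k" "s \<in> blk B l"
        using cases[OF qs] False by blast
      have "j = k" using uniq[of j k q] ij kl by simp
      then have "i < l \<or> (i = l \<and> is_hom B i)" using ij kl by (metis le_trans le_antisym le_less)
      then show ?thesis using ij kl unfolding bp_preorder_def by blast
    qed
  qed
  ultimately show ?thesis unfolding preorder_on_def by blast
qed

lemma preorder_on_edge_contraction:
  assumes r: "preorder_on A r" and "edge_contraction A r r'"
  shows "preorder_on A r'"
proof -
  obtain g h where gh: "(g, h) \<in> hasse_edges A r" and r': "r' = (r \<union> h \<times> g)\<^sup>+"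
    using assms(2) unfolding edge_contraction_def by blast
  have "g \<subseteq> A" "h \<subseteq> A"
    using gh r unfolding hasse_edges_def preorder_classes_def preorder_on_def quotient_def by blast+
  then have "r \<union> h \<times> g \<subseteq> A \<times> A"
    using r unfolding preorder_on_def by blast
  then have "r' \<subseteq> A \<times> A"
    unfolding r' by (rule trancl_subset_Sigma)
  moreover have "refl_on A r'"
    using r unfolding r' preorder_on_def refl_on_def by blast
  ultimately show ?thesis
    unfolding preorder_on_def r' by simp
qed

end

theory Submission
  imports Defs
begin

text \<open>A preorder \<open>r\<^sub>1\<close> on a finite set is a contraction of \<open>r\<^sub>2\<close> iff it is generated by \<open>r\<^sub>2\<close>
  together with reversals of pairs of \<open>r\<^sub>2\<close>: a reversed path of such steps consists of such steps
  again, which makes the property transitive, and conversely a reversed pair of \<open>r\<^sub>2\<close> whose interval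
  is minimal is a Hasse edge that can be contracted. For binary partitions, conditions (1), (3) and
  (4) say that the preorder of \<open>B\<close> is contained in that of \<open>C\<close>, and (2) and (5) say that two elements
  of a non-homogeneous block of \<open>B\<close> that become comparable do so through an element outside the block.\<close>

section \<open>Contractions of preorders\<close>

text \<open>Intersecting with \<open>r'\<close> takes the largest admissible set of reversed pairs,
  so no set of them has to be quantified over. The inclusion opposite to the third conjunct follows
  from the first two.\<close>

definition gen_by_reversal :: "('a \<times> 'a) set \<Rightarrow> ('a \<times> 'a) set \<Rightarrow> bool" where
  "gen_by_reversal r r' \<longleftrightarrow> r \<subseteq> r' \<and> trans r' \<and> r' \<subseteq> (r \<union> (r\<inverse> \<inter> r'))\<^sup>+"

lemma gen_by_reversal_refl: "trans r \<Longrightarrow> gen_by_reversal r r"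
  unfolding gen_by_reversal_def by auto

text \<open>A pair of \<open>r'\<close> is a path of pairs of \<open>r\<close> and reversals of such
  pairs. Traversed backwards, each step is again of one of these two kinds, provided that it holds
  in \<open>r''\<close>.\<close>

lemma gen_by_reversal_trans:
  assumes 1: "gen_by_reversal r r'" and 2: "gen_by_reversal r' r''"
  shows "gen_by_reversal r r''"
proof -
  let ?R = "(r \<union> (r\<inverse> \<inter> r''))\<^sup>+"
  have sub: "r \<subseteq> r'" "r' \<subseteq> r''" and tr: "trans r'" "trans r''"
    using 1 2 unfolding gen_by_reversal_def by auto
  have r': "r' \<subseteq> (r \<union> (r\<inverse> \<inter> r'))\<^sup>+" and r'': "r'' \<subseteq> (r' \<union> (r'\<inverse> \<inter> r''))\<^sup>+"
    using 1 2 unfolding gen_by_reversal_def by auto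
  have "r' \<subseteq> ?R"
    using r' sub trancl_mono_subset[of "r \<union> (r\<inverse> \<inter> r')" "r \<union> (r\<inverse> \<inter> r'')"] by blast
  have path: "(y, x) \<in> ?R" if "(x, y) \<in> (r \<union> (r\<inverse> \<inter> r'))\<^sup>+" "(y, x) \<in> r''" for x y
    using that
  proof (induction rule: trancl_induct)
    case (base y)
    then show ?case by auto
  next
    case (step y z)
    have "(x, y) \<in> r'"
      using step.hyps(1) tr sub trancl_mono_subset[of "r \<union> (r\<inverse> \<inter> r')" r'] trancl_id[OF tr(1)]
      by blast
    \<comment> \<open>The path from \<open>x\<close> to \<open>z\<close> and the pair
      \<open>(z, x)\<close> close up to a cycle in \<open>r''\<close>, so every step of the path may
      be reversed there.\<close>
    then have "(z, y) \<in> r''" "(y, x) \<in> r''"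
      using step.hyps(2) step.prems tr sub unfolding trans_def by blast+
    then have "(z, y) \<in> ?R" using step.hyps(2) by auto
    then show ?case using step.IH[OF \<open>(y, x) \<in> r''\<close>] by (rule trancl_trans)
  qed
  then have "r'\<inverse> \<inter> r'' \<subseteq> ?R" using r' by blast
  then have "(r' \<union> (r'\<inverse> \<inter> r''))\<^sup>+ \<subseteq> ?R\<^sup>+"
    using \<open>r' \<subseteq> ?R\<close> by (intro trancl_mono_subset) blast
  then have "r'' \<subseteq> ?R" using r'' by auto
  then show ?thesis using sub tr unfolding gen_by_reversal_def by blast
qed

section \<open>Equivalence classes and Hasse edges\<close>

lemma preorder_class_eq:
  assumes "preorder_on A r" "g \<in> preorder_classes A r" "x \<in> g"
  shows "g = {y. (x, y) \<in> r \<and> (y, x) \<in> r}"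
proof -
  have "trans r" using assms(1) unfolding preorder_on_def by blast
  moreover obtain z where "g = (r \<inter> r\<inverse>) `` {z}"
    using assms(2) unfolding preorder_classes_def by (rule quotientE)
  ultimately show ?thesis using assms(3) unfolding trans_def by blast
qed

lemma preorder_class_self:
  assumes "x \<in> A"
  shows "{y. (x, y) \<in> r \<and> (y, x) \<in> r} \<in> preorder_classes A r"
proof -
  have "{y. (x, y) \<in> r \<and> (y, x) \<in> r} = (r \<inter> r\<inverse>) `` {x}" by blast
  then show ?thesis unfolding preorder_classes_def using assms by (simp add: quotientI)
qed

text \<open>\<open>class_le\<close> asks only for some pair of representatives; transitivity inside
  the two classes carries the relation over to all of them.\<close>

lemma hasse_edge_less:
  assumes r: "preorder_on A r" and e: "(g, h) \<in> hasse_edges A r" and "x \<in> g" "y \<in> h"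
  shows "(x, y) \<in> r" "(y, x) \<notin> r"
proof -
  have gh: "g \<in> preorder_classes A r" "h \<in> preorder_classes A r" "g \<noteq> h" "class_le r g h"
    using e unfolding hasse_edges_def class_less_def by auto
  note eq = preorder_class_eq[OF r]
  have tr: "trans r" using r unfolding preorder_on_def by blast
  obtain u v where uv: "u \<in> g" "v \<in> h" "(u, v) \<in> r"
    using gh(4) unfolding class_le_def by blast
  have "(x, u) \<in> r" "(v, y) \<in> r"
    using eq[OF gh(1) \<open>x \<in> g\<close>] eq[OF gh(2) \<open>y \<in> h\<close>] uv by blast+
  then show xy: "(x, y) \<in> r" using uv(3) tr unfolding trans_def by blast
  show "(y, x) \<notin> r"
  proof
    assume "(y, x) \<in> r"
    then have "y \<in> g" using eq[OF gh(1) \<open>x \<in> g\<close>] xy by blast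
    then have "g = h" using eq[OF gh(1)] eq[OF gh(2) \<open>y \<in> h\<close>] by blast
    then show False using gh(3) by blast
  qed
qed

text \<open>All pairs in \<open>h \<times> g\<close> are reversals of pairs of \<open>r\<close>,
  because \<open>g\<close> lies below \<open>h\<close> for every choice of representatives.\<close>

lemma edge_contraction_gen_by_reversal:
  assumes r: "preorder_on A r" and "edge_contraction A r r'"
  shows "gen_by_reversal r r'"
proof -
  obtain g h where e: "(g, h) \<in> hasse_edges A r" and r': "r' = (r \<union> h \<times> g)\<^sup>+"
    using assms(2) unfolding edge_contraction_def by blast
  have "h \<times> g \<subseteq> r\<inverse>" using hasse_edge_less(1)[OF r e] by blast
  moreover have "h \<times> g \<subseteq> r'" unfolding r' by blast
  ultimately have "r \<union> h \<times> g \<subseteq> r \<union> (r\<inverse> \<inter> r')" by blast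
  then have "r' \<subseteq> (r \<union> (r\<inverse> \<inter> r'))\<^sup>+" using trancl_mono_subset unfolding r' by blast
  then show ?thesis unfolding gen_by_reversal_def r' by auto
qed

text \<open>Induction on the size of the interval between \<open>x\<close> and \<open>y\<close>. If
  the two classes do not form a Hasse edge, a class lies strictly between them, and for any
  \<open>z\<close> in it the pair \<open>(x, z)\<close> is again reversed in \<open>r1\<close> but
  has a smaller interval.\<close>

lemma ex_reversed_hasse_edge:
  assumes fin: "finite A" and r: "preorder_on A r" and r1: "trans r1" "r \<subseteq> r1"
    and xy: "(x, y) \<in> r" "(y, x) \<in> r1 - r"
  shows "\<exists>(g, h) \<in> hasse_edges A r. h \<times> g \<subseteq> r1"
  using xy
proof (induction "card {w. (x, w) \<in> r \<and> (w, y) \<in> r}" arbitrary: x y rule: less_induct)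
  case (less x y)
  have tr: "trans r" and rA: "r \<subseteq> A \<times> A" and refl: "refl_on A r"
    using r unfolding preorder_on_def by auto
  have xyA: "x \<in> A" "y \<in> A" using less.prems(1) rA by auto
  let ?c = "\<lambda>x. {y. (x, y) \<in> r \<and> (y, x) \<in> r}"
  have mem: "x \<in> ?c x" "y \<in> ?c y" using xyA refl unfolding refl_on_def by auto
  have cl: "?c x \<in> preorder_classes A r" "?c y \<in> preorder_classes A r"
    using preorder_class_self[of _ A r] xyA by blast+
  have lt: "class_less r (?c x) (?c y)"
    unfolding class_less_def class_le_def using mem less.prems by blast
  show ?case
  proof (cases "(?c x, ?c y) \<in> hasse_edges A r")
    case True
    have "?c y \<times> ?c x \<subseteq> r1"
      using less.prems r1 unfolding trans_def by blast
    then show ?thesis using True by blast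
  next
    case False
    then obtain k where k: "k \<in> preorder_classes A r" "class_less r (?c x) k" "class_less r k (?c y)"
      using cl lt unfolding hasse_edges_def by blast
    obtain z where z: "z \<in> k" "(x, z) \<in> r"
      using k(2) tr unfolding class_less_def class_le_def trans_def by blast
    have kz: "k = ?c z" using preorder_class_eq[OF r k(1) z(1)] .
    have zy: "(z, y) \<in> r"
      using k(3) tr unfolding kz class_less_def class_le_def trans_def by blast
    have zx: "(z, x) \<notin> r"
      using k(2) z(2) tr unfolding kz class_less_def trans_def by blast
    have yz: "(y, z) \<notin> r"
      using k(3) zy tr unfolding kz class_less_def trans_def by blast
    \<comment> \<open>The element \<open>y\<close> belongs to the larger interval only, since
      \<open>(y, z)\<close> is not in \<open>r\<close>.\<close>
    have "{w. (x, w) \<in> r \<and> (w, z) \<in> r} \<subset> {w. (x, w) \<in> r \<and> (w, y) \<in> r}"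
      using tr zy yz less.prems(1) mem(2) unfolding trans_def by blast
    moreover have "finite {w. (x, w) \<in> r \<and> (w, y) \<in> r}"
      using rA by (intro finite_subset[OF _ fin]) auto
    ultimately have "card {w. (x, w) \<in> r \<and> (w, z) \<in> r} < card {w. (x, w) \<in> r \<and> (w, y) \<in> r}"
      by (intro psubset_card_mono)
    moreover have "(z, x) \<in> r1 - r" using zx zy less.prems(2) r1 unfolding trans_def by blast
    ultimately show ?thesis using less.hyps z(2) by blast
  qed
qed

text \<open>Induction on the number of pairs of \<open>r1\<close> still missing from
  \<open>r\<close>. Contracting a Hasse edge whose reversal lies in \<open>r1\<close> adds at least
  one such pair, stays inside \<open>r1\<close> and preserves
  \<open>gen_by_reversal\<close>.\<close>

lemma gen_by_reversal_edge_contractions: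
  assumes "finite A" "preorder_on A r" "r1 \<subseteq> A \<times> A" "gen_by_reversal r r1"
  shows "(edge_contraction A)\<^sup>*\<^sup>* r r1"
  using assms(2,4)
proof (induction "card (r1 - r)" arbitrary: r rule: less_induct)
  case (less r)
  have g: "r \<subseteq> r1" "trans r1" "r1 \<subseteq> (r \<union> (r\<inverse> \<inter> r1))\<^sup>+"
    using less.prems(2) unfolding gen_by_reversal_def by auto
  show ?case
  proof (cases "r1 = r")
    case False
    have tr: "trans r" using less.prems(1) unfolding preorder_on_def by blast
    \<comment> \<open>Without a new reversed pair the generated relation would be \<open>r\<close>
      itself, which is already transitive.\<close>
    have "\<not> r\<inverse> \<inter> r1 \<subseteq> r"
    proof
      assume "r\<inverse> \<inter> r1 \<subseteq> r"
      then have "r \<union> (r\<inverse> \<inter> r1) = r" by blast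
      then have "r1 \<subseteq> r" using g(3) trancl_id[OF tr] by simp
      then show False using g(1) False by blast
    qed
    then obtain x y where "(x, y) \<in> r" "(y, x) \<in> r1 - r" by blast
    from ex_reversed_hasse_edge[OF assms(1) less.prems(1) g(2,1) this]
    obtain a b where e: "(a, b) \<in> hasse_edges A r" and ba: "b \<times> a \<subseteq> r1" by blast
    define r' where "r' = (r \<union> b \<times> a)\<^sup>+"
    have ec: "edge_contraction A r r'" unfolding edge_contraction_def r'_def using e by blast
    have pre: "preorder_on A r'" using preorder_on_edge_contraction[OF less.prems(1) ec] .
    have "r' \<subseteq> r1\<^sup>+" unfolding r'_def using g(1) ba by (intro trancl_mono_subset) blast
    then have r'1: "r' \<subseteq> r1" using trancl_id[OF g(2)] by simp
    have rr': "r \<subseteq> r'" unfolding r'_def by auto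
    then have "r1 \<subseteq> (r' \<union> (r'\<inverse> \<inter> r1))\<^sup>+"
      using g(3) trancl_mono_subset[of "r \<union> (r\<inverse> \<inter> r1)" "r' \<union> (r'\<inverse> \<inter> r1)"] by blast
    then have gen: "gen_by_reversal r' r1" using r'1 g(2) unfolding gen_by_reversal_def by blast
    obtain x y where xy: "x \<in> a" "y \<in> b"
      using e unfolding hasse_edges_def class_less_def class_le_def by blast
    then have "(y, x) \<in> r' - r"
      using hasse_edge_less(2)[OF less.prems(1) e] unfolding r'_def by blast
    then have "r1 - r' \<subset> r1 - r" using rr' r'1 by blast
    moreover have "finite (r1 - r)"
      using assms(1,3) by (meson finite_Diff finite_SigmaI finite_subset)
    ultimately have "(edge_contraction A)\<^sup>*\<^sup>* r' r1"
      using less.hyps pre gen by (meson psubset_card_mono)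
    then show ?thesis using ec by (meson converse_rtranclp_into_rtranclp)
  qed simp
qed

text \<open>This eliminates the sequence of intermediate preorders: only a condition on the two end
  preorders is left to check.\<close>

theorem preorder_contraction_iff_gen_by_reversal:
  assumes "finite A" "preorder_on A r1" "preorder_on A r2"
  shows "preorder_contraction A r1 r2 \<longleftrightarrow> gen_by_reversal r2 r1"
proof
  assume "preorder_contraction A r1 r2"
  then have "(edge_contraction A)\<^sup>*\<^sup>* r2 r1" unfolding preorder_contraction_def by blast
  then have "preorder_on A r1 \<and> gen_by_reversal r2 r1"
  proof (induction rule: rtranclp_induct)
    case base
    then show ?case using assms(3) gen_by_reversal_refl unfolding preorder_on_def by blast
  next
    case (step r r')
    then show ?case
      using preorder_on_edge_contraction edge_contraction_gen_by_reversal gen_by_reversal_trans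
      by blast
  qed
  then show "gen_by_reversal r2 r1" by blast
next
  assume "gen_by_reversal r2 r1"
  moreover have "r1 \<subseteq> A \<times> A" using assms(2) unfolding preorder_on_def by blast
  ultimately show "preorder_contraction A r1 r2"
    using assms gen_by_reversal_edge_contractions unfolding preorder_contraction_def by blast
qed

section \<open>Binary partitions through block indices\<close>

definition block_index :: "labelled_blocks \<Rightarrow> nat \<Rightarrow> nat" where
  "block_index B p = (THE i. i < length B \<and> p \<in> blk B i)"

text \<open>Covering gives existence of the index and disjointness its uniqueness. Keeping the
  bounds inside the equivalence makes it a rewrite rule without side conditions.\<close>

lemma mem_blk_iff:
  assumes B: "binary_partition n B"
  shows "i < length B \<and> p \<in> blk B i \<longleftrightarrow> p \<le> n \<and> block_index B p = i"
proof -
  have un: "(\<Union>i<length B. blk B i) = {0..n}"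
    and disj: "\<And>i j. i < length B \<Longrightarrow> j < length B \<Longrightarrow> p \<in> blk B i \<Longrightarrow> p \<in> blk B j \<Longrightarrow> i = j"
    using B unfolding binary_partition_def by blast+
  have eq: "block_index B p = i" if "i < length B" "p \<in> blk B i" for i
    unfolding block_index_def using that disj by (intro the_equality) auto
  show ?thesis
  proof
    assume "i < length B \<and> p \<in> blk B i"
    moreover from this have "p \<in> (\<Union>i<length B. blk B i)" by blast
    ultimately show "p \<le> n \<and> block_index B p = i" using eq un by simp
  next
    assume p: "p \<le> n \<and> block_index B p = i"
    then have "p \<in> (\<Union>i<length B. blk B i)" using un by simp
    then obtain j where "j < length B" "p \<in> blk B j" by blast
    then show "i < length B \<and> p \<in> blk B i" using eq p by blast
  qed
qed

lemma ex_in_block: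
  assumes "binary_partition n B" "i < length B"
  shows "\<exists>p\<le>n. block_index B p = i"
proof -
  have "blk B i \<noteq> {}" using assms unfolding binary_partition_def by simp
  then obtain p where "p \<in> blk B i" by blast
  then show ?thesis using mem_blk_iff[OF assms(1), of i p] assms(2) by auto
qed

text \<open>The convention that singletons are non-homogeneous enters the argument through this
  fact.\<close>

lemma hom_block_ex_other:
  assumes B: "binary_partition n B" and p: "p \<le> n" "is_hom B (block_index B p)"
  shows "\<exists>q\<le>n. q \<noteq> p \<and> block_index B q = block_index B p"
proof -
  have i: "block_index B p < length B" "p \<in> blk B (block_index B p)"
    using mem_blk_iff[OF B] p(1) by blast+
  then have "card (blk B (block_index B p)) \<noteq> 1"
    using B p(2) unfolding binary_partition_def by blast
  then have "blk B (block_index B p) \<noteq> {p}" by auto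
  then obtain q where "q \<in> blk B (block_index B p)" "q \<noteq> p" using i(2) by blast
  then show ?thesis using mem_blk_iff[OF B] i(1) by blast
qed

lemma bp_preorder_iff:
  assumes B: "binary_partition n B"
  shows "(p, q) \<in> bp_preorder n B \<longleftrightarrow> p \<le> n \<and> q \<le> n \<and>
    (block_index B p < block_index B q \<or>
     block_index B p = block_index B q \<and> is_hom B (block_index B p) \<or> p = q)"
proof -
  have 1: "(\<exists>i j. i < j \<and> j < length B \<and> p \<in> blk B i \<and> q \<in> blk B j) \<longleftrightarrow>
      p \<le> n \<and> q \<le> n \<and> block_index B p < block_index B q"
  proof -
    \<comment> \<open>The bound on \<open>i\<close> is implied by \<open>i < j\<close>; it is
      inserted so that \<open>mem_blk_iff\<close> applies to both memberships.\<close>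
    have "?thesis \<longleftrightarrow> ((\<exists>i j. i < j \<and> (i < length B \<and> p \<in> blk B i) \<and> (j < length B \<and> q \<in> blk B j)) \<longleftrightarrow>
        p \<le> n \<and> q \<le> n \<and> block_index B p < block_index B q)"
      by (meson order.strict_trans)
    then show ?thesis unfolding mem_blk_iff[OF B] by blast
  qed
  have 2: "(\<exists>i<length B. is_hom B i \<and> p \<in> blk B i \<and> q \<in> blk B i) \<longleftrightarrow>
      p \<le> n \<and> q \<le> n \<and> block_index B p = block_index B q \<and> is_hom B (block_index B p)"
  proof -
    have "?thesis \<longleftrightarrow> ((\<exists>i. is_hom B i \<and> (i < length B \<and> p \<in> blk B i) \<and> (i < length B \<and> q \<in> blk B i)) \<longleftrightarrow>
        p \<le> n \<and> q \<le> n \<and> block_index B p = block_index B q \<and> is_hom B (block_index B p))"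
      by blast
    then show ?thesis unfolding mem_blk_iff[OF B] by auto
  qed
  show ?thesis unfolding bp_preorder_def using 1 2 by (auto simp: Id_on_iff)
qed

section \<open>Edges, neighbourhoods and degrees of the bipartite graph\<close>

lemma graph_edge_iff:
  assumes "binary_partition n B" "binary_partition n C"
  shows "{Inl i, Inr j} \<in> graph_edges B C \<longleftrightarrow> (\<exists>p\<le>n. block_index B p = i \<and> block_index C p = j)"
proof -
  have "{Inl i, Inr j} \<in> graph_edges B C \<longleftrightarrow>
      (\<exists>p. (i < length B \<and> p \<in> blk B i) \<and> (j < length C \<and> p \<in> blk C j))"
    unfolding graph_edges_def by (auto simp: doubleton_eq_iff)
  then show ?thesis using mem_blk_iff[OF assms(1)] mem_blk_iff[OF assms(2)] by blast
qed

lemma neighbours_Inl: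
  assumes "binary_partition n B" "binary_partition n C"
  shows "neighbours B C (Inl i) = Inr ` block_index C ` {p. p \<le> n \<and> block_index B p = i}"
proof -
  have "block_index C p < length C" if "p \<le> n" for p using mem_blk_iff[OF assms(2)] that by blast
  moreover have "{Inl i, Inl k} \<notin> graph_edges B C" for k
    unfolding graph_edges_def by (auto simp: doubleton_eq_iff)
  ultimately show ?thesis
    unfolding neighbours_def left_vertices_def right_vertices_def
    by (auto simp: graph_edge_iff[OF assms])
qed

lemma neighbours_Inr:
  assumes "binary_partition n B" "binary_partition n C"
  shows "neighbours B C (Inr j) = Inl ` block_index B ` {p. p \<le> n \<and> block_index C p = j}"
proof -
  have "block_index B p < length B" if "p \<le> n" for p using mem_blk_iff[OF assms(1)] that by blast
  moreover have "{Inr j, Inr k} \<notin> graph_edges B C" for k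
    unfolding graph_edges_def by (auto simp: doubleton_eq_iff)
  moreover have "{Inr j, Inl k} \<in> graph_edges B C \<longleftrightarrow>
      (\<exists>p\<le>n. block_index B p = k \<and> block_index C p = j)" for k
    using graph_edge_iff[OF assms, of k j] by (simp add: insert_commute)
  ultimately show ?thesis
    unfolding neighbours_def left_vertices_def right_vertices_def by auto
qed

lemma finite_neighbours: "finite (neighbours B C v)"
  unfolding neighbours_def left_vertices_def right_vertices_def by simp

lemma deg_eq_card_neighbours: "deg B C v = card (neighbours B C v)"
proof -
  have "neighbours B C v =
      {w \<in> neighbours B C v. hom_vertex B C w} \<union> {w \<in> neighbours B C v. \<not> hom_vertex B C w}"
    by blast
  then show ?thesis
    unfolding deg_def deg_star_def deg_vee_def
    using finite_neighbours by (subst card_Un_disjoint[symmetric]) auto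
qed

text \<open>The predicate is arbitrary because condition (3) needs homogeneity here and condition
  (4) its negation.\<close>

lemma card_filter_1_0_iff:
  assumes "finite N"
  shows "card {w \<in> N. P w} = 1 \<and> card {w \<in> N. \<not> P w} = 0 \<longleftrightarrow> (\<exists>w. N = {w} \<and> P w)"
proof
  assume c: "card {w \<in> N. P w} = 1 \<and> card {w \<in> N. \<not> P w} = 0"
  then have "{w \<in> N. \<not> P w} = {}" using assms by simp
  moreover obtain w where "{w \<in> N. P w} = {w}" using c by (meson card_1_singletonE)
  ultimately show "\<exists>w. N = {w} \<and> P w" by (intro exI[of _ w]) blast
next
  assume "\<exists>w. N = {w} \<and> P w"
  then obtain w where "N = {w}" "P w" by blast
  then show "card {w \<in> N. P w} = 1 \<and> card {w \<in> N. \<not> P w} = 0" by (simp add: Collect_conv_if)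
qed

lemma deg_star_1_vee_0_iff:
  "deg_star B C v = 1 \<and> deg_vee B C v = 0 \<longleftrightarrow> (\<exists>w. neighbours B C v = {w} \<and> hom_vertex B C w)"
  unfolding deg_star_def deg_vee_def using finite_neighbours by (rule card_filter_1_0_iff)

lemma deg_star_0_vee_1_iff:
  "deg_star B C v = 0 \<and> deg_vee B C v = 1 \<longleftrightarrow> (\<exists>w. neighbours B C v = {w} \<and> \<not> hom_vertex B C w)"
  using card_filter_1_0_iff[OF finite_neighbours, of B C v "\<lambda>w. \<not> hom_vertex B C w"]
  unfolding deg_star_def deg_vee_def by (simp add: conj_commute)

lemma deg_1_imp_star_1_iff:
  "(deg B C v = 1 \<longrightarrow> deg_star B C v = 1) \<longleftrightarrow> (\<forall>w. neighbours B C v = {w} \<longrightarrow> hom_vertex B C w)"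
proof (cases "\<exists>w. neighbours B C v = {w}")
  case True
  then obtain w where "neighbours B C v = {w}" by blast
  then show ?thesis
    unfolding deg_eq_card_neighbours deg_star_def by (simp add: Collect_conv_if)
next
  case False
  then show ?thesis unfolding deg_eq_card_neighbours One_nat_def card_1_singleton_iff by simp
qed

section \<open>The conditions on the graph, elementwise\<close>

text \<open>Blocks are nonempty, so every vertex is the block of some element and vertex conditions
  become conditions on elements of \<open>[0,n]\<close>.\<close>

lemma ball_left_vertices_iff:
  assumes "binary_partition n B"
  shows "(\<forall>v\<in>left_vertices B. P v) \<longleftrightarrow> (\<forall>p\<le>n. P (Inl (block_index B p)))"
proof -
  have "block_index B p < length B" if "p \<le> n" for p using mem_blk_iff[OF assms] that by blast
  then show ?thesis unfolding left_vertices_def using ex_in_block[OF assms] by auto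
qed

lemma ball_right_vertices_iff:
  assumes "binary_partition n C"
  shows "(\<forall>v\<in>right_vertices C. P v) \<longleftrightarrow> (\<forall>p\<le>n. P (Inr (block_index C p)))"
proof -
  have "block_index C p < length C" if "p \<le> n" for p using mem_blk_iff[OF assms] that by blast
  then show ?thesis unfolding right_vertices_def using ex_in_block[OF assms] by auto
qed

lemma image_eq_singleton_iff:
  assumes "x \<in> X"
  shows "f ` X = {y} \<longleftrightarrow> y = f x \<and> (\<forall>z\<in>X. f z = f x)"
proof
  assume eq: "f ` X = {y}"
  have "f z = y" if "z \<in> X" for z
    using imageI[OF that, of f] unfolding eq by simp
  then show "y = f x \<and> (\<forall>z\<in>X. f z = f x)" using assms by simp
next
  assume "y = f x \<and> (\<forall>z\<in>X. f z = f x)"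
  then have "\<forall>z\<in>X. f z = y" by metis
  then show "f ` X = {y}" using assms by force
qed

lemma neighbours_Inl_singleton_iff:
  assumes "binary_partition n B" "binary_partition n C" "p \<le> n"
  shows "neighbours B C (Inl (block_index B p)) = {w} \<longleftrightarrow> w = Inr (block_index C p) \<and>
    (\<forall>q\<le>n. block_index B q = block_index B p \<longrightarrow> block_index C q = block_index C p)"
proof -
  have "p \<in> {q. q \<le> n \<and> block_index B q = block_index B p}" using assms(3) by simp
  then show ?thesis
    unfolding neighbours_Inl[OF assms(1,2)] image_image by (subst image_eq_singleton_iff) auto
qed

lemma neighbours_Inr_singleton_iff:
  assumes "binary_partition n B" "binary_partition n C" "p \<le> n"
  shows "neighbours B C (Inr (block_index C p)) = {w} \<longleftrightarrow> w = Inl (block_index B p) \<and>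
    (\<forall>q\<le>n. block_index C q = block_index C p \<longrightarrow> block_index B q = block_index B p)"
proof -
  have "p \<in> {q. q \<le> n \<and> block_index C q = block_index C p}" using assms(3) by simp
  then show ?thesis
    unfolding neighbours_Inr[OF assms(1,2)] image_image by (subst image_eq_singleton_iff) auto
qed

lemma non_crossing_iff:
  assumes "binary_partition n B" "binary_partition n C"
  shows "non_crossing B C \<longleftrightarrow> (\<forall>p\<le>n. \<forall>q\<le>n.
    block_index B p < block_index B q \<longrightarrow> block_index C p \<le> block_index C q)"
proof -
  have "non_crossing B C \<longleftrightarrow> \<not> (\<exists>p\<le>n. \<exists>q\<le>n.
      block_index B p < block_index B q \<and> block_index C q < block_index C p)"
    unfolding non_crossing_def graph_edge_iff[OF assms] by blast
  then show ?thesis by (meson not_less)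
qed

text \<open>A cardinality is at most one iff any two members agree. Only non-homogeneous neighbours
  are counted, hence the restriction on the blocks of both \<open>p\<close> and \<open>q\<close> in
  \<open>C\<close>.\<close>

lemma left_nonhom_condition_iff:
  assumes "binary_partition n B" "binary_partition n C"
  shows "(\<forall>v\<in>left_vertices B. \<not> hom_vertex B C v \<longrightarrow> deg_vee B C v \<le> 1) \<longleftrightarrow>
    (\<forall>p\<le>n. \<forall>q\<le>n. block_index B p = block_index B q \<and> \<not> is_hom B (block_index B p) \<and>
      \<not> is_hom C (block_index C p) \<and> \<not> is_hom C (block_index C q) \<longrightarrow>
      block_index C p = block_index C q)"
proof -
  have "deg_vee B C (Inl i) \<le> 1 \<longleftrightarrow> (\<forall>p\<le>n. \<forall>q\<le>n. block_index B p = i \<and> block_index B q = i \<and>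
      \<not> is_hom C (block_index C p) \<and> \<not> is_hom C (block_index C q) \<longrightarrow>
      block_index C p = block_index C q)" for i
  proof -
    have eq: "{w \<in> neighbours B C (Inl i). \<not> hom_vertex B C w} =
        Inr ` block_index C ` {p. p \<le> n \<and> block_index B p = i \<and> \<not> is_hom C (block_index C p)}"
      unfolding neighbours_Inl[OF assms] by auto
    have fin: "finite (block_index C `
        {p. p \<le> n \<and> block_index B p = i \<and> \<not> is_hom C (block_index C p)})"
      by simp
    show ?thesis
      unfolding deg_vee_def eq card_image[OF inj_Inr] One_nat_def card_le_Suc0_iff_eq[OF fin] by blast
  qed
  then show ?thesis unfolding ball_left_vertices_iff[OF assms(1)] hom_vertex.simps by metis
qed

lemma left_hom_condition_iff:
  assumes "binary_partition n B" "binary_partition n C"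
  shows "(\<forall>v\<in>left_vertices B. hom_vertex B C v \<longrightarrow> deg_star B C v = 1 \<and> deg_vee B C v = 0) \<longleftrightarrow>
    (\<forall>p\<le>n. \<forall>q\<le>n. block_index B p = block_index B q \<and> is_hom B (block_index B p) \<longrightarrow>
      block_index C p = block_index C q \<and> is_hom C (block_index C p))"
proof -
  have "(\<exists>w. neighbours B C (Inl (block_index B p)) = {w} \<and> hom_vertex B C w) \<longleftrightarrow>
      is_hom C (block_index C p) \<and>
      (\<forall>q\<le>n. block_index B q = block_index B p \<longrightarrow> block_index C q = block_index C p)"
    if "p \<le> n" for p
    unfolding neighbours_Inl_singleton_iff[OF assms that] by auto
  then show ?thesis
    unfolding ball_left_vertices_iff[OF assms(1)] deg_star_1_vee_0_iff hom_vertex.simps by metis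
qed

lemma right_nonhom_condition_iff:
  assumes "binary_partition n B" "binary_partition n C"
  shows "(\<forall>v\<in>right_vertices C. \<not> hom_vertex B C v \<longrightarrow> deg_star B C v = 0 \<and> deg_vee B C v = 1) \<longleftrightarrow>
    (\<forall>p\<le>n. \<forall>q\<le>n. block_index C p = block_index C q \<and> \<not> is_hom C (block_index C p) \<longrightarrow>
      block_index B p = block_index B q \<and> \<not> is_hom B (block_index B p))"
proof -
  have "(\<exists>w. neighbours B C (Inr (block_index C p)) = {w} \<and> \<not> hom_vertex B C w) \<longleftrightarrow>
      \<not> is_hom B (block_index B p) \<and>
      (\<forall>q\<le>n. block_index C q = block_index C p \<longrightarrow> block_index B q = block_index B p)"
    if "p \<le> n" for p
    unfolding neighbours_Inr_singleton_iff[OF assms that] by auto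
  then show ?thesis
    unfolding ball_right_vertices_iff[OF assms(2)] deg_star_0_vee_1_iff hom_vertex.simps by metis
qed

text \<open>Degree one of a right vertex means that its block is contained in a single block of
  \<open>B\<close>, which is what the inner quantifier expresses.\<close>

lemma right_hom_condition_iff:
  assumes "binary_partition n B" "binary_partition n C"
  shows "(\<forall>v\<in>right_vertices C. hom_vertex B C v \<longrightarrow> deg B C v = 1 \<longrightarrow> deg_star B C v = 1) \<longleftrightarrow>
    (\<forall>p\<le>n. is_hom C (block_index C p) \<and>
      (\<forall>q\<le>n. block_index C q = block_index C p \<longrightarrow> block_index B q = block_index B p) \<longrightarrow>
      is_hom B (block_index B p))"
proof -
  have "(\<forall>w. neighbours B C (Inr (block_index C p)) = {w} \<longrightarrow> hom_vertex B C w) \<longleftrightarrow>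
      ((\<forall>q\<le>n. block_index C q = block_index C p \<longrightarrow> block_index B q = block_index B p) \<longrightarrow>
        is_hom B (block_index B p))"
    if "p \<le> n" for p
    unfolding neighbours_Inr_singleton_iff[OF assms that] by auto
  then show ?thesis
    unfolding ball_right_vertices_iff[OF assms(2)] deg_1_imp_star_1_iff hom_vertex.simps by blast
qed

section \<open>Contractions of binary partitions\<close>

text \<open>The three conjuncts are conditions (1), (3) and (4). Distinct elements are equivalent
  only inside a homogeneous block, and incomparable only inside a non-homogeneous one.\<close>

lemma bp_preorder_subset_iff:
  assumes "binary_partition n B" "binary_partition n C"
  shows "bp_preorder n B \<subseteq> bp_preorder n C \<longleftrightarrow>
    (\<forall>p\<le>n. \<forall>q\<le>n. block_index B p < block_index B q \<longrightarrow> block_index C p \<le> block_index C q) \<and>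
    (\<forall>p\<le>n. \<forall>q\<le>n. block_index B p = block_index B q \<and> is_hom B (block_index B p) \<longrightarrow>
      block_index C p = block_index C q \<and> is_hom C (block_index C p)) \<and>
    (\<forall>p\<le>n. \<forall>q\<le>n. block_index C p = block_index C q \<and> \<not> is_hom C (block_index C p) \<longrightarrow>
      block_index B p = block_index B q \<and> \<not> is_hom B (block_index B p))"
    (is "?S \<longleftrightarrow> ?N \<and> ?H \<and> ?V")
proof
  note iff = bp_preorder_iff[OF assms(1)] bp_preorder_iff[OF assms(2)]
  assume S: ?S
  then have sub: "(p, q) \<in> bp_preorder n B \<Longrightarrow> (p, q) \<in> bp_preorder n C" for p q by blast
  have ?N
  proof (intro allI impI)
    fix p q
    assume "p \<le> n" "q \<le> n" "block_index B p < block_index B q"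
    then have "(p, q) \<in> bp_preorder n B" unfolding iff by blast
    then show "block_index C p \<le> block_index C q" using sub[of p q] unfolding iff by auto
  qed
  moreover have H: ?H
  proof (intro allI impI)
    fix p q
    assume p: "p \<le> n" and q: "q \<le> n"
      and h: "block_index B p = block_index B q \<and> is_hom B (block_index B p)"
    have eq: "block_index C p = block_index C s \<and> is_hom C (block_index C p)"
      if "s \<le> n" "s \<noteq> p" "block_index B s = block_index B p" for s
      using sub[of p s] sub[of s p] p h that unfolding iff by auto
    \<comment> \<open>For \<open>q = p\<close> the inclusion says nothing about the label in
      \<open>C\<close>; a second element of the homogeneous block supplies it.\<close>
    obtain s where "s \<le> n" "s \<noteq> p" "block_index B s = block_index B p"
      using hom_block_ex_other[OF assms(1) p] h by blast
    then show "block_index C p = block_index C q \<and> is_hom C (block_index C p)"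
      using eq[of s] eq[of q] q h by metis
  qed
  moreover have ?V
  proof (intro allI impI)
    fix p q
    assume p: "p \<le> n" and q: "q \<le> n"
      and h: "block_index C p = block_index C q \<and> \<not> is_hom C (block_index C p)"
    have "\<not> block_index B x < block_index B y"
      if "x \<le> n" "y \<le> n" "block_index C x = block_index C y" "\<not> is_hom C (block_index C x)" for x y
    proof
      assume less: "block_index B x < block_index B y"
      then have "(x, y) \<in> bp_preorder n B" using that unfolding iff by blast
      then have "(x, y) \<in> bp_preorder n C" by (rule sub)
      then have "x = y" using that(3,4) unfolding iff by simp
      then show False using less by simp
    qed
    from this[of p q] this[of q p]
    have "\<not> block_index B p < block_index B q" "\<not> block_index B q < block_index B p"
      using p q h by metis+
    moreover have "\<not> is_hom B (block_index B p)" using H p h by blast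
    ultimately show "block_index B p = block_index B q \<and> \<not> is_hom B (block_index B p)" by simp
  qed
  ultimately show "?N \<and> ?H \<and> ?V" by blast
next
  assume "?N \<and> ?H \<and> ?V"
  then have N: ?N and H: ?H and V: ?V by blast+
  show ?S
  proof (rule subrelI)
    fix p q
    assume "(p, q) \<in> bp_preorder n B"
    then consider (less) "p \<le> n" "q \<le> n" "block_index B p < block_index B q"
      | (hom) "p \<le> n" "q \<le> n" "block_index B p = block_index B q" "is_hom B (block_index B p)"
      | (eq) "p \<le> n" "p = q"
      unfolding bp_preorder_iff[OF assms(1)] by blast
    then show "(p, q) \<in> bp_preorder n C"
    proof cases
      case less
      have "block_index C p \<le> block_index C q" using N less by blast
      \<comment> \<open>Elements of different blocks of \<open>B\<close> may share a block of
        \<open>C\<close> only if it is homogeneous, by \<open>?V\<close>.\<close>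
      moreover have "is_hom C (block_index C p)" if "block_index C p = block_index C q"
        using V less that by (metis less_irrefl)
      ultimately show ?thesis
        using less(1,2) unfolding bp_preorder_iff[OF assms(2)] by linarith
    next
      case hom
      then show ?thesis using H unfolding bp_preorder_iff[OF assms(2)] by blast
    next
      case eq
      then show ?thesis unfolding bp_preorder_iff[OF assms(2)] by blast
    qed
  qed
qed

text \<open>This yields the necessity of condition (2), once it is applied to \<open>p\<close>,
  \<open>q\<close> in both orders.\<close>

lemma nonhom_blocks_of_reversal:
  assumes B: "binary_partition n B" and C: "binary_partition n C"
    and gen: "gen_by_reversal (bp_preorder n B) (bp_preorder n C)"
    and p: "p \<le> n" and q: "q \<le> n" and eq: "block_index B p = block_index B q"
    and nh: "\<not> is_hom B (block_index B p)" "\<not> is_hom C (block_index C p)" "\<not> is_hom C (block_index C q)"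
  shows "\<not> block_index C p < block_index C q"
proof
  assume less: "block_index C p < block_index C q"
  let ?r = "bp_preorder n B" and ?r' = "bp_preorder n C"
  note iffB = bp_preorder_iff[OF B] and iffC = bp_preorder_iff[OF C]
  have sub: "?r \<subseteq> ?r'" and tr: "trans ?r'" and cl: "?r' \<subseteq> (?r \<union> (?r\<inverse> \<inter> ?r'))\<^sup>+"
    using gen unfolding gen_by_reversal_def by auto
  \<comment> \<open>The class of \<open>p\<close> in \<open>?r'\<close> is a singleton, so a path from \<open>p\<close> leaves it by a step that raises the
    block index in \<open>B\<close>, hence strictly above \<open>q\<close>, and cannot come back to \<open>q\<close>, whose class is a
    singleton too.\<close>
  have leave: "w = p \<or> (q, w) \<in> ?r' \<and> w \<noteq> q" if "(p, w) \<in> ?r \<union> (?r\<inverse> \<inter> ?r')" for w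
  proof (cases "(p, w) \<in> ?r")
    case True
    then consider "w = p" | "w \<le> n" "block_index B p < block_index B w"
      using nh(1) unfolding iffB by auto
    then show ?thesis
    proof cases
      case 2
      then have "(q, w) \<in> ?r" using q eq unfolding iffB by simp
      moreover have "w \<noteq> q" using 2 eq by auto
      ultimately show ?thesis using sub by blast
    qed simp
  next
    case False
    then have "(w, p) \<in> ?r'" "(p, w) \<in> ?r'" using that sub by auto
    then show ?thesis using nh(2) unfolding iffC by auto
  qed
  have "w = p \<or> (q, w) \<in> ?r' \<and> w \<noteq> q" if "(p, w) \<in> (?r \<union> (?r\<inverse> \<inter> ?r'))\<^sup>+" for w
    using that
  proof (induction rule: trancl_induct)
    case (base w)
    then show ?case by (rule leave)
  next
    case (step w w')
    show ?case
    proof (cases "w = p")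
      case True
      then show ?thesis using step.hyps(2) leave by blast
    next
      case False
      have ww': "(w, w') \<in> ?r'" using step.hyps(2) sub by blast
      have qw: "(q, w) \<in> ?r'" "w \<noteq> q" using False step.IH by auto
      then have "(q, w') \<in> ?r'" using ww' tr unfolding trans_def by blast
      moreover have "w' \<noteq> q" using qw ww' nh(3) unfolding iffC by auto
      ultimately show ?thesis by blast
    qed
  qed
  moreover have "(p, q) \<in> ?r'" using less p q unfolding iffC by blast
  moreover have "p \<noteq> q" using less by auto
  ultimately show False using cl by blast
qed

text \<open>Necessity of condition (5). If a homogeneous block of \<open>C\<close> lay inside a
  non-homogeneous block of \<open>B\<close>, its elements would be pairwise incomparable in
  \<open>B\<close>. No generating step could then join two of them, although the block has at least
  two elements.\<close>

lemma hom_block_of_reversal: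
  assumes B: "binary_partition n B" and C: "binary_partition n C"
    and gen: "gen_by_reversal (bp_preorder n B) (bp_preorder n C)"
    and p: "p \<le> n" "is_hom C (block_index C p)"
    and const: "\<And>q. q \<le> n \<Longrightarrow> block_index C q = block_index C p \<Longrightarrow> block_index B q = block_index B p"
  shows "is_hom B (block_index B p)"
proof (rule ccontr)
  assume nh: "\<not> is_hom B (block_index B p)"
  let ?r = "bp_preorder n B" and ?r' = "bp_preorder n C"
  note iffB = bp_preorder_iff[OF B] and iffC = bp_preorder_iff[OF C]
  have sub: "?r \<subseteq> ?r'" and tr: "trans ?r'" and cl: "?r' \<subseteq> (?r \<union> (?r\<inverse> \<inter> ?r'))\<^sup>+"
    using gen unfolding gen_by_reversal_def by auto
  have S: "(?r \<union> (?r\<inverse> \<inter> ?r'))\<^sup>+ \<subseteq> ?r'"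
    using sub trancl_mono_subset[of "?r \<union> (?r\<inverse> \<inter> ?r')" ?r'] trancl_id[OF tr] by blast
  have loop: "w = p" if "(p, w) \<in> ?r \<union> (?r\<inverse> \<inter> ?r')" "(p, w) \<in> ?r'" "(w, p) \<in> ?r'" for w
  proof -
    have "w \<le> n" "block_index C w = block_index C p" using that(2,3) unfolding iffC by auto
    then have "block_index B w = block_index B p" by (rule const)
    then show ?thesis using that(1) nh unfolding Un_iff Int_iff converse_iff iffB by auto
  qed
  have "w = p" if "(p, w) \<in> (?r \<union> (?r\<inverse> \<inter> ?r'))\<^sup>+" "(w, p) \<in> ?r'" for w
    using that
  proof (induction rule: trancl_induct)
    case (base w)
    then show ?case using loop sub by blast
  next
    case (step w w')
    \<comment> \<open>A path that ends in the class of \<open>p\<close> in \<open>?r'\<close> never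
      leaves this class, so \<open>loop\<close> applies to each of its steps.\<close>
    have "(p, w) \<in> ?r'" "(w, w') \<in> ?r'" using step.hyps S sub by blast+
    moreover from this have "(w, p) \<in> ?r'" using step.prems tr unfolding trans_def by blast
    ultimately show ?case using step.IH step.hyps(2) step.prems loop by blast
  qed
  moreover obtain q where "q \<le> n" "q \<noteq> p" "block_index C q = block_index C p"
    using hom_block_ex_other[OF C p] by blast
  then have "(p, q) \<in> ?r'" "(q, p) \<in> ?r'" "q \<noteq> p" using p unfolding iffC by auto
  ultimately show False using cl by blast
qed

text \<open>Sufficiency. The critical pairs are distinct elements of one non-homogeneous block of
  \<open>B\<close>. They are joined by a detour through an element \<open>w\<close> of another block
  of \<open>B\<close>, with one step in the preorder of \<open>B\<close> and the other a
  reversal.\<close>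

lemma gen_by_reversal_bp_preorder:
  assumes B: "binary_partition n B" and C: "binary_partition n C"
    and sub: "bp_preorder n B \<subseteq> bp_preorder n C"
    and mono: "\<And>p q. p \<le> n \<Longrightarrow> q \<le> n \<Longrightarrow> block_index B p < block_index B q \<Longrightarrow>
      block_index C p \<le> block_index C q"
    and left: "\<And>p q. p \<le> n \<Longrightarrow> q \<le> n \<Longrightarrow> block_index B p = block_index B q \<Longrightarrow>
      \<not> is_hom B (block_index B p) \<Longrightarrow> \<not> is_hom C (block_index C p) \<Longrightarrow>
      \<not> is_hom C (block_index C q) \<Longrightarrow> block_index C p = block_index C q"
    and right: "\<And>p. p \<le> n \<Longrightarrow> is_hom C (block_index C p) \<Longrightarrow> \<not> is_hom B (block_index B p) \<Longrightarrow>
      \<exists>q\<le>n. block_index C q = block_index C p \<and> block_index B q \<noteq> block_index B p"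
  shows "gen_by_reversal (bp_preorder n B) (bp_preorder n C)"
proof -
  let ?r = "bp_preorder n B" and ?r' = "bp_preorder n C"
  let ?R = "(?r \<union> (?r\<inverse> \<inter> ?r'))\<^sup>+"
  note iffB = bp_preorder_iff[OF B] and iffC = bp_preorder_iff[OF C]
  have up: "(p, q) \<in> ?R" if "(p, q) \<in> ?r" for p q using that by blast
  have down: "(p, q) \<in> ?R" if "(q, p) \<in> ?r" "(p, q) \<in> ?r'" for p q using that by blast
  have "(p, q) \<in> ?R" if pq: "(p, q) \<in> ?r'" for p q
  proof -
    have n: "p \<le> n" "q \<le> n" using pq unfolding iffC by auto
    consider "p = q \<or> block_index B p < block_index B q \<or>
        block_index B p = block_index B q \<and> is_hom B (block_index B p)"
      | "block_index B q < block_index B p"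
      | "p \<noteq> q" "block_index B p = block_index B q" "\<not> is_hom B (block_index B p)"
      by linarith
    then show ?thesis
    proof cases
      case 1
      then show ?thesis using up n unfolding iffB by blast
    next
      case 2
      then show ?thesis using down pq n unfolding iffB by blast
    next
      case 3
      \<comment> \<open>If both labels were non-homogeneous, \<open>left\<close> would put
        \<open>p\<close> and \<open>q\<close> into one non-homogeneous block of \<open>C\<close>,
        where distinct elements are incomparable.\<close>
      consider "is_hom C (block_index C p)" | "is_hom C (block_index C q)"
        using pq left[OF n 3(2,3)] 3(1) unfolding iffC by fastforce
      then obtain w where w: "w \<le> n" "block_index B w \<noteq> block_index B p"
        "block_index C w = block_index C p \<and> is_hom C (block_index C p) \<or>
         block_index C w = block_index C q \<and> is_hom C (block_index C q)"
        using right[OF n(1)] right[OF n(2)] 3 by metis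
      have le: "block_index C p \<le> block_index C q" using pq unfolding iffC by auto
      have "block_index B w < block_index B p \<or> block_index B p < block_index B w"
        using w(2) by linarith
      then have "(p, w) \<in> ?R \<and> (w, q) \<in> ?R"
      proof
        assume lt: "block_index B w < block_index B p"
        then have "block_index C w \<le> block_index C p" using mono w(1) n(1) by blast
        \<comment> \<open>If \<open>w\<close> was chosen in the block of \<open>q\<close>, then
          \<open>le\<close> and the previous inequality force the blocks of \<open>p\<close>,
          \<open>q\<close> and \<open>w\<close> in \<open>C\<close> to coincide. The other case is
          symmetric.\<close>
        then have "(p, w) \<in> ?r'" using w le n unfolding iffC by auto
        then show ?thesis using up[of w q] down[of w p] lt w(1) n 3(2) unfolding iffB by simp
      next
        assume lt: "block_index B p < block_index B w"
        then have "block_index C q \<le> block_index C w" using mono w(1) n(2) 3(2) by simp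
        then have "(w, q) \<in> ?r'" using w le n unfolding iffC by auto
        then show ?thesis using up[of p w] down[of q w] lt w(1) n 3(2) unfolding iffB by simp
      qed
      then show ?thesis by (meson trancl_trans)
    qed
  qed
  moreover have "trans ?r'" using preorder_on_bp_preorder[OF C] unfolding preorder_on_def by blast
  ultimately show ?thesis using sub unfolding gen_by_reversal_def by auto
qed

theorem theorem3p7:
  fixes n :: nat and B C :: labelled_blocks
  assumes "binary_partition n B" and "binary_partition n C"
  shows "bp_contraction n C B \<longleftrightarrow>
    non_crossing B C \<and>
    (\<forall>v\<in>left_vertices B. \<not> hom_vertex B C v \<longrightarrow> deg_vee B C v \<le> 1) \<and>
    (\<forall>v\<in>left_vertices B. hom_vertex B C v \<longrightarrow> deg_star B C v = 1 \<and> deg_vee B C v = 0) \<and>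
    (\<forall>v\<in>right_vertices C. \<not> hom_vertex B C v \<longrightarrow> deg_star B C v = 0 \<and> deg_vee B C v = 1) \<and>
    (\<forall>v\<in>right_vertices C. hom_vertex B C v \<longrightarrow> deg B C v = 1 \<longrightarrow> deg_star B C v = 1)"
proof -
  have "bp_contraction n C B \<longleftrightarrow> gen_by_reversal (bp_preorder n B) (bp_preorder n C)"
    unfolding bp_contraction_def using assms
    by (intro preorder_contraction_iff_gen_by_reversal preorder_on_bp_preorder) auto
  \<comment> \<open>The inclusion stands for conditions (1), (3) and (4), the other two conjuncts
    for (2) and (5).\<close>
  also have "\<dots> \<longleftrightarrow> bp_preorder n B \<subseteq> bp_preorder n C \<and>
    (\<forall>p\<le>n. \<forall>q\<le>n. block_index B p = block_index B q \<and> \<not> is_hom B (block_index B p) \<and>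
      \<not> is_hom C (block_index C p) \<and> \<not> is_hom C (block_index C q) \<longrightarrow>
      block_index C p = block_index C q) \<and>
    (\<forall>p\<le>n. is_hom C (block_index C p) \<and>
      (\<forall>q\<le>n. block_index C q = block_index C p \<longrightarrow> block_index B q = block_index B p) \<longrightarrow>
      is_hom B (block_index B p))"
    (is "?G \<longleftrightarrow> ?S \<and> ?L \<and> ?R")
  proof
    assume G: ?G
    then have ?S unfolding gen_by_reversal_def by blast
    moreover have ?L
    proof (intro allI impI)
      fix p q
      assume p: "p \<le> n" and q: "q \<le> n" and
        h: "block_index B p = block_index B q \<and> \<not> is_hom B (block_index B p) \<and>
          \<not> is_hom C (block_index C p) \<and> \<not> is_hom C (block_index C q)"
      then have "\<not> block_index C p < block_index C q" "\<not> block_index C q < block_index C p"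
        using nonhom_blocks_of_reversal[OF assms G] by metis+
      then show "block_index C p = block_index C q" by linarith
    qed
    moreover have ?R using hom_block_of_reversal[OF assms G] by blast
    ultimately show "?S \<and> ?L \<and> ?R" by blast
  next
    assume A: "?S \<and> ?L \<and> ?R"
    show ?G
    proof (rule gen_by_reversal_bp_preorder[OF assms])
      show ?S using A by blast
    next
      have "\<forall>p\<le>n. \<forall>q\<le>n. block_index B p < block_index B q \<longrightarrow> block_index C p \<le> block_index C q"
        using iffD1[OF bp_preorder_subset_iff[OF assms] conjunct1[OF A]] by (rule conjunct1)
      then show "block_index C p \<le> block_index C q"
        if "p \<le> n" "q \<le> n" "block_index B p < block_index B q" for p q
        using that by blast
    next
      show "block_index C p = block_index C q"
        if "p \<le> n" "q \<le> n" "block_index B p = block_index B q" "\<not> is_hom B (block_index B p)"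
          "\<not> is_hom C (block_index C p)" "\<not> is_hom C (block_index C q)" for p q
        using conjunct1[OF conjunct2[OF A]] that by metis
    next
      show "\<exists>q\<le>n. block_index C q = block_index C p \<and> block_index B q \<noteq> block_index B p"
        if "p \<le> n" "is_hom C (block_index C p)" "\<not> is_hom B (block_index B p)" for p
        using conjunct2[OF conjunct2[OF A]] that by metis
    qed
  qed
  finally show ?thesis
    unfolding bp_preorder_subset_iff[OF assms] non_crossing_iff[OF assms]
      left_nonhom_condition_iff[OF assms] left_hom_condition_iff[OF assms]
      right_nonhom_condition_iff[OF assms] right_hom_condition_iff[OF assms]
    \<comment> \<open>After unfolding, the two sides differ only in the order and grouping of the
      five conjuncts.\<close>
    by (rule trans) (rule iffI; elim conjE; intro conjI; assumption)
qed

end
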